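(* Consider the scheme defined in the context, applied to linear advection $\partial_t u+\nabla\cdot(\bm a u)=0$ with constant velocity $\bm a\in\mathbb{R}^3$, i.e. $\bm f(u)=\bm a u$. Put $\|\bm u\|^2_{M_m+K_m}=\hat{\bm u}_m(M_m+K_m)\hat{\bm u}_m^T$ on each element $m$. (i) On each element, $$\frac12\frac{d}{dt}\|\bm u\|^2_{M_m+K_m}=-\sum_{f=1}^{N_f}\sum_{k=1}^{N_{fp}}u_m(\xi_{f,k})\,W_{f,k}\,\Big[\big(\hat{\bm n}^r C_m(\xi_{f,k})^T\big)\cdot\big(\bm f_m^*-\tfrac12\bm f_m\big)\Big],$$ where $u_m(\xi)=\chi(\xi)\hat{\bm u}_m^T$ and $\bm f_m=\bm a\,u_m$ at the facet node. (ii) With periodic boundary conditions, the total energy $E=\sum_m\|\bm u\|^2_{M_m+K_m}$ is constant in time if $\bm f^*$ is the central numerical flux, and is monotonically non-increasing in time if $\bm f^*$ is the upwind numerical flux.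
   Context: Reference element and basis: $\Omega_r=[-1,1]^3$ with coordinates $\xi=(\xi_1,\xi_2,\xi_3)$, $p\ge1$, $N_p=(p+1)^3$, and $\chi(\xi)=[\chi_1(\xi),\dots,\chi_{N_p}(\xi)]$ (row vector) a basis of the tensor-product polynomials of degree at most $p$ in each variable. The domain is partitioned into finitely many elements $\Omega_m$, each the image of $\Omega_r$ under a time-independent, possibly non-affine, mapping $\Theta_m$ with $J_m=\det(\partial x/\partial\xi)>0$. $C_m(\xi)\in\mathbb{R}^{3\times3}$ is the metric cofactor matrix (continuously $C_m^T=J_m(\partial x/\partial\xi)^{-1}$; in the scheme, its discrete evaluation at the nodes). The solution in element $m$ is $u_m=\chi\hat{\bm u}_m(t)^T$ with $\hat{\bm u}_m\in\mathbb{R}^{1\times N_p}$. Quadrature: volume nodes $\xi_{v,q}$, $q=1,\dots,N_{vp}$, with diagonal weight matrix $W$; facet nodes $\xi_{f,k}$ with weights $W_{f,k}>0$ on the faces $f=1,\dots,N_f$ of $\Omega_r$; $\hat{\bm n}^r$ is the outward reference unit normal (row vector). $\chi(\xi_v)$ is the $N_{vp}\times N_p$ matrix of basis values, and $\chi_{\xi_j}(\xi_v)$ that of $\xi_j$-derivatives. The rules satisfy discrete integration by parts: with $S_j=\chi(\xi_v)^TW\chi_{\xi_j}(\xi_v)$, $S_j+S_j^T=\sum_{f,k}\chi(\xi_{f,k})^TW_{f,k}\hat n^r_j\chi(\xi_{f,k})$. $M=\chi(\xi_v)^TW\chi(\xi_v)$ is invertible, $\chi_{\xi_j}(\xi_v)=\chi(\xi_v)M^{-1}S_j$,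 and $\Pi=M^{-1}\chi(\xi_v)^TW$ is the discrete $L_2$ projection. Norm: $M_m=\chi(\xi_v)^TWJ_m\chi(\xi_v)$, with $J_m$ the diagonal matrix of Jacobian determinants at volume nodes, and $$K_m=\sum_{(s,v,w)}c_{(s,v,w)}\,\partial^{(s,v,w)}\chi(\xi_v)^T\,WJ_m\,\partial^{(s,v,w)}\chi(\xi_v),$$ the sum over $s,v,w\in\{0,p\}$ with $s+v+w\ge p$, where $\partial^{(s,v,w)}=\partial^{s+v+w}/\partial\xi_1^s\partial\xi_2^v\partial\xi_3^w$ and $c_{(s,v,w)}=c_{1D}^{(s+v+w)/p}$. The parameter $c_{1D}$ is such that $M_m+K_m$ is symmetric positive definite. Fluxes: $\hat{\bm f}_{m,i}^T=\Pi\,[f_i(u_m(\xi_{v,q}))]_q$ are the coefficients of the $i$th physical flux component ($i=1,2,3$), and $\hat{\bm f}^{r\,T}_{m,j}=\Pi\,[\sum_i f_i(u_m(\xi_{v,q}))(C_m(\xi_{v,q}))_{ij}]_q$ those of the $j$th reference flux component. Write $\nabla^r\chi(\xi_v)\cdot\hat{\bm f}_m^{r\,T}=\sum_j\chi_{\xi_j}(\xi_v)\hat{\bm f}^{r\,T}_{m,j}$ and $\tilde\nabla^r\chi(\xi_v)\cdot\hat{\bm f}_m^T=\sum_{i,j}\mathrm{diag}_q\big((C_m(\xi_{v,q}))_{ij}\big)\chi_{\xi_j}(\xi_v)\hat{\bm f}_{m,i}^T$. At a facet node, $\bm f_m$ is the physical flux (the interpolated projected flux $\chi(\xi_{f,k})\hat{\bm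 f}_m^T$, which equals $\bm a u_m$ for linear advection), $\bm f_m^*$ is the numerical flux, and $\bm f_m^{C,r}=\bm f_m^*C_m(\xi_{f,k})-\tfrac12\bm f_mC_m(\xi_{f,k})-\tfrac12\chi(\xi_{f,k})\hat{\bm f}_m^{r\,T}$. Scheme: for every element $m$, $$(M_m+K_m)\frac{d\hat{\bm u}_m^T}{dt}+\tfrac12\chi(\xi_v)^TW\big[\nabla^r\chi(\xi_v)\cdot\hat{\bm f}_m^{r\,T}+\tilde\nabla^r\chi(\xi_v)\cdot\hat{\bm f}_m^T\big]+\sum_{f,k}\chi(\xi_{f,k})^TW_{f,k}\,[\hat{\bm n}^r\cdot\bm f_m^{C,r}]=\bm0^T .$$ Mesh: conforming and water-tight, and periodic for part (ii). At each facet node shared by two elements the node positions and weights coincide, and the vectors $\hat{\bm n}^rC_m^T$ computed from the two sides are negatives of each other. With $\bm\nu=\hat{\bm n}^rC_m^T$ on the interior side, and $u^-,u^+$ the interior and exterior values, the central flux is $\bm f^*=\bm a\,(u^-+u^+)/2$, and the upwind flux is single valued with $\bm\nu\cdot\bm f^*=(\bm\nu\cdot\bm a)\frac{u^-+u^+}{2}+\frac12|\bm\nu\cdot\bm a|(u^--u^+)$. *)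

theory Defs
  imports "HOL-Analysis.Analysis"
begin

section \<open>Reference element and polynomial basis\<close>

definition ref_element :: "(real^3) set" where
  "ref_element = cbox (- 1) 1"

text \<open>The face \<open>(j, s)\<close> of the cube is \<open>\<xi>\<^sub>j = 1\<close> if \<open>s\<close> holds and \<open>\<xi>\<^sub>j = -1\<close> otherwise.\<close>

type_synonym face = "3 \<times> bool"

definition face_sign :: "face \<Rightarrow> real" where
  "face_sign F = (if snd F then 1 else - 1)"

definition ref_face :: "face \<Rightarrow> (real^3) set" where
  "ref_face F = {\<xi> \<in> ref_element. \<xi> $ fst F = face_sign F}"

definition ref_normal :: "face \<Rightarrow> real^3" where
  "ref_normal F = face_sign F *\<^sub>R axis (fst F) 1"

definition tensor_polys :: "nat \<Rightarrow> (real^3 \<Rightarrow> real) set" where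
  "tensor_polys p = {g. \<exists>c :: nat \<Rightarrow> nat \<Rightarrow> nat \<Rightarrow> real. \<forall>\<xi>.
     g \<xi> = (\<Sum>i\<le>p. \<Sum>j\<le>p. \<Sum>k\<le>p. c i j k * (\<xi>$1)^i * (\<xi>$2)^j * (\<xi>$3)^k)}"

definition is_tensor_basis :: "nat \<Rightarrow> ('b::finite \<Rightarrow> real^3 \<Rightarrow> real) \<Rightarrow> bool" where
  "is_tensor_basis p \<phi> \<longleftrightarrow> range \<phi> \<subseteq> tensor_polys p \<and>
     (\<forall>g \<in> tensor_polys p. \<exists>!c :: real^'b. \<forall>\<xi>. g \<xi> = (\<Sum>b\<in>UNIV. c $ b * \<phi> b \<xi>))"

definition partial_deriv :: "3 \<Rightarrow> (real^3 \<Rightarrow> real) \<Rightarrow> real^3 \<Rightarrow> real" where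
  "partial_deriv j g \<xi> = deriv (\<lambda>h. g (\<xi> + h *\<^sub>R axis j 1)) 0"

definition mixed_deriv :: "nat \<times> nat \<times> nat \<Rightarrow> (real^3 \<Rightarrow> real) \<Rightarrow> real^3 \<Rightarrow> real" where
  "mixed_deriv = (\<lambda>(s, v, w) g.
     (partial_deriv 1 ^^ s) ((partial_deriv 2 ^^ v) ((partial_deriv 3 ^^ w) g)))"

section \<open>Quadrature and discrete operators\<close>

definition diag_matrix :: "('n::finite \<Rightarrow> real) \<Rightarrow> real^'n^'n" where
  "diag_matrix d = (\<chi> i j. if i = j then d i else 0)"

text \<open>The index types \<open>'b\<close>, \<open>'q\<close>, \<open>'k\<close> enumerate the basis functions, the volume nodes and the
  nodes of each face. Row vectors are elements of \<open>real^'n\<close>, so transposes of vectors are implicit.\<close>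

record ('b, 'q, 'k) discretization =
  poly_deg :: nat
  basis :: "'b \<Rightarrow> real^3 \<Rightarrow> real"
  vol_node :: "'q \<Rightarrow> real^3"
  vol_weight :: "'q \<Rightarrow> real"
  facet_node :: "face \<Rightarrow> 'k \<Rightarrow> real^3"
  facet_weight :: "face \<Rightarrow> 'k \<Rightarrow> real"
  c1D :: real

definition vol_values ::
  "('b::finite, 'q::finite, 'k::finite) discretization \<Rightarrow> ('b \<Rightarrow> real^3 \<Rightarrow> real) \<Rightarrow> real^'b^'q" where
  "vol_values D g = (\<chi> q b. g b (vol_node D q))"

definition chi_v :: "('b::finite, 'q::finite, 'k::finite) discretization \<Rightarrow> real^'b^'q" where
  "chi_v D = vol_values D (basis D)"

definition chi_v_deriv ::
  "('b::finite, 'q::finite, 'k::finite) discretization \<Rightarrow> 3 \<Rightarrow> real^'b^'q" where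
  "chi_v_deriv D j = vol_values D (\<lambda>b. partial_deriv j (basis D b))"

definition chi_f ::
  "('b::finite, 'q::finite, 'k::finite) discretization \<Rightarrow> face \<Rightarrow> 'k \<Rightarrow> real^'b" where
  "chi_f D f k = (\<chi> b. basis D b (facet_node D f k))"

definition weight_matrix :: "('b::finite, 'q::finite, 'k::finite) discretization \<Rightarrow> real^'q^'q" where
  "weight_matrix D = diag_matrix (vol_weight D)"

definition ref_mass :: "('b::finite, 'q::finite, 'k::finite) discretization \<Rightarrow> real^'b^'b" where
  "ref_mass D = transpose (chi_v D) ** weight_matrix D ** chi_v D"

definition ref_stiffness ::
  "('b::finite, 'q::finite, 'k::finite) discretization \<Rightarrow> 3 \<Rightarrow> real^'b^'b" where
  "ref_stiffness D j = transpose (chi_v D) ** weight_matrix D ** chi_v_deriv D j"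

definition L2_projection :: "('b::finite, 'q::finite, 'k::finite) discretization \<Rightarrow> real^'q^'b" where
  "L2_projection D = matrix_inv (ref_mass D) ** transpose (chi_v D) ** weight_matrix D"

definition discrete_integration_by_parts ::
  "('b::finite, 'q::finite, 'k::finite) discretization \<Rightarrow> bool" where
  "discrete_integration_by_parts D \<longleftrightarrow> (\<forall>j.
     ref_stiffness D j + transpose (ref_stiffness D j) =
     (\<chi> b b'. \<Sum>f\<in>UNIV. \<Sum>k\<in>UNIV.
        chi_f D f k $ b * facet_weight D f k * ref_normal f $ j * chi_f D f k $ b'))"

definition valid_discretization :: "('b::finite, 'q::finite, 'k::finite) discretization \<Rightarrow> bool" where
  "valid_discretization D \<longleftrightarrow>
     poly_deg D \<ge> 1 \<and> CARD('b) = (poly_deg D + 1) ^ 3 \<and>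
     is_tensor_basis (poly_deg D) (basis D) \<and>
     (\<forall>q. vol_node D q \<in> ref_element) \<and>
     (\<forall>f k. facet_node D f k \<in> ref_face f \<and> facet_weight D f k > 0) \<and>
     discrete_integration_by_parts D \<and>
     invertible (ref_mass D) \<and>
     (\<forall>j. chi_v_deriv D j = chi_v D ** matrix_inv (ref_mass D) ** ref_stiffness D j)"

section \<open>Mesh\<close>

text \<open>\<open>cofactor M m\<close> is the discrete metric cofactor matrix. It need not agree with the exact one
  computed from \<open>elem_map M m\<close>, and it is only evaluated at nodes. \<open>neighbour M (m, f)\<close> is the
  element-face pair glued to face \<open>f\<close> of \<open>m\<close>, or \<open>None\<close> at a true boundary, and
  \<open>node_match M (m, f)\<close> maps the facet nodes to the nodes they meet there. Points are
  identified modulo integer combinations of \<open>periods M\<close> (empty without periodicity).\<close>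

record ('m, 'k) mesh =
  elem_map :: "'m \<Rightarrow> real^3 \<Rightarrow> real^3"
  cofactor :: "'m \<Rightarrow> real^3 \<Rightarrow> real^3^3"
  neighbour :: "'m \<times> face \<Rightarrow> ('m \<times> face) option"
  node_match :: "'m \<times> face \<Rightarrow> 'k \<Rightarrow> 'k"
  periods :: "(real^3) set"

definition jac_det :: "('m::finite, 'k::finite) mesh \<Rightarrow> 'm \<Rightarrow> real^3 \<Rightarrow> real" where
  "jac_det M m \<xi> = det (jacobian (elem_map M m) (at \<xi> within ref_element))"

definition element :: "('m::finite, 'k::finite) mesh \<Rightarrow> 'm \<Rightarrow> (real^3) set" where
  "element M m = elem_map M m ` ref_element"

definition valid_elements :: "('m::finite, 'k::finite) mesh \<Rightarrow> bool" where
  "valid_elements M \<longleftrightarrow>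
     (\<forall>m. elem_map M m differentiable_on ref_element \<and> (\<forall>\<xi>\<in>ref_element. jac_det M m \<xi> > 0)) \<and>
     (\<forall>m m'. m \<noteq> m' \<longrightarrow> interior (element M m) \<inter> interior (element M m') = {})"

definition period_lattice :: "(real^3) set \<Rightarrow> (real^3) set" where
  "period_lattice P = {\<Sum>x\<in>P. of_int (z x) *\<^sub>R x | z :: real^3 \<Rightarrow> int. True}"

text \<open>The vector \<open>\<nu> = n C\<^sup>T\<close> at a facet node.\<close>

definition scaled_normal ::
  "('b::finite, 'q::finite, 'k::finite) discretization \<Rightarrow> ('m::finite, 'k) mesh \<Rightarrow>
   'm \<Rightarrow> face \<Rightarrow> 'k \<Rightarrow> real^3" where
  "scaled_normal D M m f k = ref_normal f v* transpose (cofactor M m (facet_node D f k))"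

definition conforming_mesh ::
  "('b::finite, 'q::finite, 'k::finite) discretization \<Rightarrow> ('m::finite, 'k) mesh \<Rightarrow> bool" where
  "conforming_mesh D M \<longleftrightarrow> independent (periods M) \<and>
     (\<forall>m f. neighbour M (m, f) = None \<longrightarrow>
        elem_map M m ` ref_face f \<subseteq> frontier (\<Union>m'. element M m')) \<and>
     (\<forall>m f m' f'. neighbour M (m, f) = Some (m', f') \<longrightarrow>
        (m', f') \<noteq> (m, f) \<and> neighbour M (m', f') = Some (m, f) \<and>
        (\<forall>k. node_match M (m', f') (node_match M (m, f) k) = k) \<and>
        (\<exists>d \<in> period_lattice (periods M).
           elem_map M m' ` ref_face f' = (\<lambda>x. x + d) ` elem_map M m ` ref_face f \<and>
           (\<forall>k. elem_map M m' (facet_node D f' (node_match M (m, f) k)) =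
                elem_map M m (facet_node D f k) + d)) \<and>
        (\<forall>k. facet_weight D f' (node_match M (m, f) k) = facet_weight D f k) \<and>
        (\<forall>k. scaled_normal D M m' f' (node_match M (m, f) k) = - scaled_normal D M m f k))"

definition periodic_mesh :: "('m::finite, 'k::finite) mesh \<Rightarrow> bool" where
  "periodic_mesh M \<longleftrightarrow> (\<forall>F. neighbour M F \<noteq> None)"

section \<open>Norm\<close>

definition elem_jac_matrix ::
  "('b::finite, 'q::finite, 'k::finite) discretization \<Rightarrow> ('m::finite, 'k) mesh \<Rightarrow>
   'm \<Rightarrow> real^'q^'q" where
  "elem_jac_matrix D M m = diag_matrix (\<lambda>q. jac_det M m (vol_node D q))"

definition elem_mass ::
  "('b::finite, 'q::finite, 'k::finite) discretization \<Rightarrow> ('m::finite, 'k) mesh \<Rightarrow>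
   'm \<Rightarrow> real^'b^'b" where
  "elem_mass D M m =
     transpose (chi_v D) ** weight_matrix D ** elem_jac_matrix D M m ** chi_v D"

definition K_indices :: "nat \<Rightarrow> (nat \<times> nat \<times> nat) set" where
  "K_indices p = {(s, v, w). s \<in> {0, p} \<and> v \<in> {0, p} \<and> w \<in> {0, p} \<and> s + v + w \<ge> p}"

text \<open>On \<open>K_indices p\<close> with \<open>p \<ge> 1\<close> the division in the exponent is exact. An integer
  power is used since \<open>c1D\<close> may be negative.\<close>

definition K_coeff :: "('b::finite, 'q::finite, 'k::finite) discretization \<Rightarrow> nat \<times> nat \<times> nat \<Rightarrow> real" where
  "K_coeff D = (\<lambda>(s, v, w). c1D D ^ ((s + v + w) div poly_deg D))"

definition elem_K ::
  "('b::finite, 'q::finite, 'k::finite) discretization \<Rightarrow> ('m::finite, 'k) mesh \<Rightarrow>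
   'm \<Rightarrow> real^'b^'b" where
  "elem_K D M m = (\<Sum>\<alpha> \<in> K_indices (poly_deg D).
     K_coeff D \<alpha> *\<^sub>R
       (transpose (vol_values D (\<lambda>b. mixed_deriv \<alpha> (basis D b))) ** weight_matrix D
        ** elem_jac_matrix D M m ** vol_values D (\<lambda>b. mixed_deriv \<alpha> (basis D b))))"

definition norm_matrix ::
  "('b::finite, 'q::finite, 'k::finite) discretization \<Rightarrow> ('m::finite, 'k) mesh \<Rightarrow>
   'm \<Rightarrow> real^'b^'b" where
  "norm_matrix D M m = elem_mass D M m + elem_K D M m"

definition sym_pos_def :: "real^'n^'n \<Rightarrow> bool" where
  "sym_pos_def A \<longleftrightarrow> transpose A = A \<and> (\<forall>x. x \<noteq> 0 \<longrightarrow> x \<bullet> (A *v x) > 0)"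

definition norm_sq ::
  "('b::finite, 'q::finite, 'k::finite) discretization \<Rightarrow> ('m::finite, 'k) mesh \<Rightarrow>
   'm \<Rightarrow> real^'b \<Rightarrow> real" where
  "norm_sq D M m uh = uh \<bullet> (norm_matrix D M m *v uh)"

definition total_energy ::
  "('b::finite, 'q::finite, 'k::finite) discretization \<Rightarrow> ('m::finite, 'k) mesh \<Rightarrow>
   ('m \<Rightarrow> real \<Rightarrow> real^'b) \<Rightarrow> real \<Rightarrow> real" where
  "total_energy D M uh t = (\<Sum>m\<in>UNIV. norm_sq D M m (uh m t))"

section \<open>Fluxes and scheme\<close>

text \<open>Throughout, \<open>F :: real \<Rightarrow> real^3\<close> is the flux function, \<open>uh\<close> the coefficient vector of the
  solution in one element, and \<open>fs\<close> the value of the numerical flux at the facet nodes of that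
  element.\<close>

definition sol_at ::
  "('b::finite, 'q::finite, 'k::finite) discretization \<Rightarrow> real^'b \<Rightarrow> real^3 \<Rightarrow> real" where
  "sol_at D uh \<xi> = (\<Sum>b\<in>UNIV. basis D b \<xi> * uh $ b)"

definition flux_coeff ::
  "('b::finite, 'q::finite, 'k::finite) discretization \<Rightarrow> (real \<Rightarrow> real^3) \<Rightarrow>
   real^'b \<Rightarrow> 3 \<Rightarrow> real^'b" where
  "flux_coeff D F uh i = L2_projection D *v (\<chi> q. F (sol_at D uh (vol_node D q)) $ i)"

definition ref_flux_coeff ::
  "('b::finite, 'q::finite, 'k::finite) discretization \<Rightarrow> ('m::finite, 'k) mesh \<Rightarrow>
   (real \<Rightarrow> real^3) \<Rightarrow> 'm \<Rightarrow> real^'b \<Rightarrow> 3 \<Rightarrow> real^'b" where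
  "ref_flux_coeff D M F m uh j = L2_projection D *v
     (\<chi> q. \<Sum>i\<in>UNIV. F (sol_at D uh (vol_node D q)) $ i * cofactor M m (vol_node D q) $ i $ j)"

definition ref_div ::
  "('b::finite, 'q::finite, 'k::finite) discretization \<Rightarrow> ('m::finite, 'k) mesh \<Rightarrow>
   (real \<Rightarrow> real^3) \<Rightarrow> 'm \<Rightarrow> real^'b \<Rightarrow> real^'q" where
  "ref_div D M F m uh = (\<Sum>j\<in>UNIV. chi_v_deriv D j *v ref_flux_coeff D M F m uh j)"

definition phys_div ::
  "('b::finite, 'q::finite, 'k::finite) discretization \<Rightarrow> ('m::finite, 'k) mesh \<Rightarrow>
   (real \<Rightarrow> real^3) \<Rightarrow> 'm \<Rightarrow> real^'b \<Rightarrow> real^'q" where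
  "phys_div D M F m uh = (\<Sum>i\<in>UNIV. \<Sum>j\<in>UNIV.
     (diag_matrix (\<lambda>q. cofactor M m (vol_node D q) $ i $ j) ** chi_v_deriv D j) *v
       flux_coeff D F uh i)"

definition facet_flux ::
  "('b::finite, 'q::finite, 'k::finite) discretization \<Rightarrow> (real \<Rightarrow> real^3) \<Rightarrow>
   real^'b \<Rightarrow> face \<Rightarrow> 'k \<Rightarrow> real^3" where
  "facet_flux D F uh f k = (\<chi> i. chi_f D f k \<bullet> flux_coeff D F uh i)"

definition facet_ref_flux ::
  "('b::finite, 'q::finite, 'k::finite) discretization \<Rightarrow> ('m::finite, 'k) mesh \<Rightarrow>
   (real \<Rightarrow> real^3) \<Rightarrow> 'm \<Rightarrow> real^'b \<Rightarrow> face \<Rightarrow> 'k \<Rightarrow> real^3" where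
  "facet_ref_flux D M F m uh f k = (\<chi> j. chi_f D f k \<bullet> ref_flux_coeff D M F m uh j)"

definition correction_flux ::
  "('b::finite, 'q::finite, 'k::finite) discretization \<Rightarrow> ('m::finite, 'k) mesh \<Rightarrow>
   (real \<Rightarrow> real^3) \<Rightarrow> 'm \<Rightarrow> real^'b \<Rightarrow> (face \<Rightarrow> 'k \<Rightarrow> real^3) \<Rightarrow> face \<Rightarrow> 'k \<Rightarrow> real^3" where
  "correction_flux D M F m uh fs f k =
     fs f k v* cofactor M m (facet_node D f k)
     - (1/2) *\<^sub>R (facet_flux D F uh f k v* cofactor M m (facet_node D f k))
     - (1/2) *\<^sub>R facet_ref_flux D M F m uh f k"

definition scheme_residual ::
  "('b::finite, 'q::finite, 'k::finite) discretization \<Rightarrow> ('m::finite, 'k) mesh \<Rightarrow>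
   (real \<Rightarrow> real^3) \<Rightarrow> 'm \<Rightarrow> real^'b \<Rightarrow> real^'b \<Rightarrow> (face \<Rightarrow> 'k \<Rightarrow> real^3) \<Rightarrow> real^'b" where
  "scheme_residual D M F m uh duh fs =
     norm_matrix D M m *v duh
     + (1/2) *\<^sub>R ((transpose (chi_v D) ** weight_matrix D) *v
                   (ref_div D M F m uh + phys_div D M F m uh))
     + (\<Sum>f\<in>UNIV. \<Sum>k\<in>UNIV.
          (facet_weight D f k * (ref_normal f \<bullet> correction_flux D M F m uh fs f k)) *\<^sub>R chi_f D f k)"

definition solves_scheme ::
  "('b::finite, 'q::finite, 'k::finite) discretization \<Rightarrow> ('m::finite, 'k) mesh \<Rightarrow>
   (real \<Rightarrow> real^3) \<Rightarrow> real set \<Rightarrow> ('m \<Rightarrow> real \<Rightarrow> real^'b) \<Rightarrow>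
   (real \<Rightarrow> 'm \<Rightarrow> face \<Rightarrow> 'k \<Rightarrow> real^3) \<Rightarrow> bool" where
  "solves_scheme D M F T uh fstar \<longleftrightarrow> (\<forall>t\<in>T. \<forall>m. \<exists>duh.
     (uh m has_vector_derivative duh) (at t within T) \<and>
     scheme_residual D M F m (uh m t) duh (fstar t m) = 0)"

section \<open>Numerical fluxes for linear advection\<close>

definition facet_sol ::
  "('b::finite, 'q::finite, 'k::finite) discretization \<Rightarrow> ('m \<Rightarrow> real \<Rightarrow> real^'b) \<Rightarrow>
   real \<Rightarrow> 'm \<Rightarrow> face \<Rightarrow> 'k \<Rightarrow> real" where
  "facet_sol D uh t m f k = sol_at D (uh m t) (facet_node D f k)"

definition central_flux ::
  "('b::finite, 'q::finite, 'k::finite) discretization \<Rightarrow> ('m::finite, 'k) mesh \<Rightarrow> real^3 \<Rightarrow>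
   real set \<Rightarrow> ('m \<Rightarrow> real \<Rightarrow> real^'b) \<Rightarrow> (real \<Rightarrow> 'm \<Rightarrow> face \<Rightarrow> 'k \<Rightarrow> real^3) \<Rightarrow> bool" where
  "central_flux D M a T uh fstar \<longleftrightarrow>
     (\<forall>t\<in>T. \<forall>m f m' f' k. neighbour M (m, f) = Some (m', f') \<longrightarrow>
        (let um = facet_sol D uh t m f k;
             up = facet_sol D uh t m' f' (node_match M (m, f) k)
         in fstar t m f k = ((um + up) / 2) *\<^sub>R a))"

definition upwind_flux ::
  "('b::finite, 'q::finite, 'k::finite) discretization \<Rightarrow> ('m::finite, 'k) mesh \<Rightarrow> real^3 \<Rightarrow>
   real set \<Rightarrow> ('m \<Rightarrow> real \<Rightarrow> real^'b) \<Rightarrow> (real \<Rightarrow> 'm \<Rightarrow> face \<Rightarrow> 'k \<Rightarrow> real^3) \<Rightarrow> bool" where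
  "upwind_flux D M a T uh fstar \<longleftrightarrow>
     (\<forall>t\<in>T. \<forall>m f m' f' k. neighbour M (m, f) = Some (m', f') \<longrightarrow>
        (let um = facet_sol D uh t m f k;
             up = facet_sol D uh t m' f' (node_match M (m, f) k);
             \<nu> = scaled_normal D M m f k
         in fstar t m' f' (node_match M (m, f) k) = fstar t m f k \<and>
            \<nu> \<bullet> fstar t m f k = (\<nu> \<bullet> a) * ((um + up) / 2) + 1/2 * \<bar>\<nu> \<bullet> a\<bar> * (um - up)))"

end

theory Submission
  imports Defs
begin

text \<open>Test the scheme with the solution itself. The volume terms are a split form: half of the
  divergence acts on the projected reference flux \<open>C u\<close>, and the other half is \<open>C\<close> times the
  gradient of \<open>u\<close>. Since the differentiation matrices factor through the discrete projection
  \<open>\<Pi>\<close> and the quadrature weights and metric factors are diagonal, the second half is exactly the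
  transpose of the first. The two halves therefore add up to the symmetrised stiffness matrix
  \<open>S\<^sub>j + S\<^sub>j\<^sup>T\<close> (\<open>split_form_energy\<close>), which discrete integration by parts turns into a
  sum over facet nodes (\<open>split_volume_energy\<close>). That sum is the contribution of the interpolated
  reference flux, which the third term of the correction flux subtracts. Only the numerical flux and
  the physical flux survive, and this is the energy balance of one element.

  For the whole periodic mesh, gluing is a involution on the facet nodes, so the total
  energy rate can be collected into pairs of nodes that meet (\<open>sum_facet_nodes_symmetrize\<close>). With
  \<open>u\<^sup>-\<close>, \<open>u\<^sup>+\<close> the two values at a pair, the terms \<open>\<nu> \<bullet> a (u\<^sup>-)\<^sup>2 / 2\<close> left by the
  central average cancel against the physical flux on each side, and the remaining cross terms
  \<open>\<nu> \<bullet> a u\<^sup>- u\<^sup>+ / 2\<close> have opposite signs on the two sides. The central flux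
  thus contributes nothing; the upwind penalty contributes dissipation proportional to
  \<open>\<bar>\<nu> \<bullet> a\<bar> (u\<^sup>- - u\<^sup>+)\<^sup>2\<close>. The sign of the derivative on the time interval then gives
  the monotonicity of the energy.\<close>

section \<open>Matrix preliminaries\<close>

lemma inner_transpose_mult: fixes A :: "real^'n^'m" shows "x \<bullet> (transpose A *v y) = (A *v x) \<bullet> y"
  by (metis dot_lmul_matrix inner_commute transpose_matrix_vector)

lemma inner_vector_matrix_mult: fixes A :: "real^'n^'m"
  shows "n \<bullet> (x v* A) = (n v* transpose A) \<bullet> x"
  by (metis dot_lmul_matrix inner_commute vector_transpose_matrix transpose_matrix_vector)

lemma matrix_inv_mult:
  fixes A :: "real^'n^'n"
  assumes "invertible A"
  shows "A ** matrix_inv A = mat 1" "matrix_inv A ** A = mat 1"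
  using someI_ex[OF assms[unfolded invertible_def]] by (auto simp: matrix_inv_def)

lemma diag_matrix_mult: "(diag_matrix d *v x) $ i = d i * x $ i"
  by (simp add: diag_matrix_def matrix_vector_mult_def if_distrib[of "\<lambda>y. y * _"] cong: if_cong)

lemma transpose_diag_matrix: "transpose (diag_matrix d) = diag_matrix d"
  by (simp add: diag_matrix_def transpose_def vec_eq_iff)

lemma diag_matrix_mult_diag: "diag_matrix c ** diag_matrix d = diag_matrix (\<lambda>i. c i * d i)"
  by (simp add: diag_matrix_def matrix_matrix_mult_def vec_eq_iff if_distrib[of "\<lambda>y. y * _"]
      if_distrib[of "\<lambda>y. _ * y"] cong: if_cong)

section \<open>Energy balance on one element\<close>

text \<open>Writing the differentiation matrix as \<open>X N\<^sup>-\<^sup>1 S\<close> is what makes the two halves of the split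
  form adjoint: with \<open>N\<close>, \<open>W\<close> and \<open>W G\<close> symmetric, moving the factors of
  \<open>u \<bullet> X\<^sup>T W G X N\<^sup>-\<^sup>1 S u\<close> to the left argument, one at a time, builds up the projection
  \<open>g = N\<^sup>-\<^sup>1 X\<^sup>T W G X u\<close> and leaves \<open>g \<bullet> S u\<close>.\<close>
lemma split_form_energy:
  fixes X Xd :: "real^'b^'q" and W G :: "real^'q^'q" and S :: "real^'b^'b" and u :: "real^'b"
  defines "N \<equiv> transpose X ** W ** X"
  assumes symW: "transpose W = W"
    and symWG: "transpose (W ** G) = W ** G"
    and inv: "invertible N"
    and S: "S = transpose X ** W ** Xd"
    and Xd: "Xd = X ** matrix_inv N ** S"
  defines "g \<equiv> (matrix_inv N ** transpose X ** W) *v (G *v (X *v u))"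
  shows "u \<bullet> ((transpose X ** W) *v (Xd *v g + G *v (Xd *v u))) = u \<bullet> ((S + transpose S) *v g)"
proof -
  have symN: "transpose N = N"
    unfolding N_def by (simp add: matrix_transpose_mul symW matrix_mul_assoc)
  have inv1: "N ** matrix_inv N = mat 1"
    using inv by (rule matrix_inv_mult)
  have symNinv: "transpose (matrix_inv N) = matrix_inv N"
  proof -
    have "transpose (matrix_inv N) ** N = mat 1"
      by (metis inv1 matrix_transpose_mul symN transpose_mat)
    then show ?thesis
      by (metis inv1 matrix_mul_assoc matrix_mul_lid matrix_mul_rid)
  qed
  have 1: "u \<bullet> ((transpose X ** W) *v (Xd *v g)) = u \<bullet> (S *v g)"
    by (simp add: S matrix_vector_mul_assoc matrix_mul_assoc)
  have "(transpose X ** W) *v (G *v (Xd *v u))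
      = transpose X *v ((W ** G) *v (X *v (matrix_inv N *v (S *v u))))"
    by (subst Xd) (simp add: matrix_vector_mul_assoc matrix_mul_assoc del: transpose_matrix_vector)
  then have "u \<bullet> ((transpose X ** W) *v (G *v (Xd *v u)))
      = u \<bullet> (transpose X *v ((W ** G) *v (X *v (matrix_inv N *v (S *v u)))))"
    by (rule arg_cong)
  also have "\<dots> = ((W ** G) *v (X *v u)) \<bullet> (X *v (matrix_inv N *v (S *v u)))"
    by (metis inner_transpose_mult symWG)
  also have "\<dots> = (matrix_inv N *v (transpose X *v ((W ** G) *v (X *v u)))) \<bullet> (S *v u)"
    by (metis inner_transpose_mult inner_commute symNinv)
  also have "\<dots> = g \<bullet> (S *v u)"
    by (simp add: g_def matrix_vector_mul_assoc matrix_mul_assoc del: transpose_matrix_vector)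
  also have "\<dots> = u \<bullet> (transpose S *v g)"
    by (metis inner_transpose_mult inner_commute)
  finally show ?thesis using 1
    by (simp add: matrix_vector_right_distrib matrix_vector_mult_add_rdistrib inner_add_right)
qed

lemma sol_at_vol_node: "sol_at D u (vol_node D q) = (chi_v D *v u) $ q"
  by (simp add: sol_at_def chi_v_def vol_values_def matrix_vector_mult_def)

lemma sol_at_facet_node: "sol_at D u (facet_node D f k) = u \<bullet> chi_f D f k"
  by (simp add: sol_at_def chi_f_def inner_vec_def mult.commute)

text \<open>The advective flux of a discrete solution lies in the polynomial space, so projecting it
  changes nothing. The metric factors of the reference flux in general lead out of that space.\<close>
lemma flux_coeff_advection:
  assumes "invertible (ref_mass D)"
  shows "flux_coeff D (\<lambda>u. u *\<^sub>R a) u i = a $ i *\<^sub>R u"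
proof -
  have "(\<chi> q. (sol_at D u (vol_node D q) *\<^sub>R a) $ i) = a $ i *\<^sub>R (chi_v D *v u)"
    by (simp add: vec_eq_iff sol_at_vol_node mult.commute)
  then have "flux_coeff D (\<lambda>u. u *\<^sub>R a) u i
      = a $ i *\<^sub>R ((matrix_inv (ref_mass D) ** ref_mass D) *v u)"
    by (simp add: flux_coeff_def L2_projection_def ref_mass_def matrix_vector_mult_scaleR
        matrix_vector_mul_assoc matrix_mul_assoc)
  then show ?thesis
    by (simp add: matrix_inv_mult[OF assms])
qed

text \<open>The \<open>j\<close>th component of the advection velocity in reference coordinates, \<open>a C\<close>, acting
  pointwise on nodal values.\<close>
definition advection_cofactor ::
  "('b::finite, 'q::finite, 'k::finite) discretization \<Rightarrow> ('m::finite, 'k) mesh \<Rightarrow> real^3 \<Rightarrow>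
   'm \<Rightarrow> 3 \<Rightarrow> real^'q^'q" where
  "advection_cofactor D M a m j = diag_matrix (\<lambda>q. \<Sum>i\<in>UNIV. a $ i * cofactor M m (vol_node D q) $ i $ j)"

lemma ref_flux_coeff_advection:
  "ref_flux_coeff D M (\<lambda>u. u *\<^sub>R a) m u j
   = L2_projection D *v (advection_cofactor D M a m j *v (chi_v D *v u))"
proof -
  have "(\<chi> q. \<Sum>i\<in>UNIV. (sol_at D u (vol_node D q) *\<^sub>R a) $ i * cofactor M m (vol_node D q) $ i $ j)
      = advection_cofactor D M a m j *v (chi_v D *v u)"
    by (simp add: vec_eq_iff sol_at_vol_node advection_cofactor_def diag_matrix_mult
        sum_distrib_left mult_ac)
  then show ?thesis by (simp add: ref_flux_coeff_def)
qed

lemma phys_div_advection: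
  assumes "invertible (ref_mass D)"
  shows "phys_div D M (\<lambda>u. u *\<^sub>R a) m u
    = (\<Sum>j\<in>UNIV. advection_cofactor D M a m j *v (chi_v_deriv D j *v u))"
  unfolding phys_div_def
  by (subst sum.swap)
     (simp add: vec_eq_iff flux_coeff_advection[OF assms] advection_cofactor_def diag_matrix_mult
        matrix_vector_mul_assoc[symmetric] matrix_vector_mult_scaleR sum_distrib_left sum_distrib_right mult_ac)

text \<open>The right-hand side is twice what the term \<open>- facet_ref_flux / 2\<close> of the correction flux
  removes; the volume terms enter the scheme with the factor \<open>1/2\<close>.\<close>
lemma split_volume_energy:
  fixes D :: "('b::finite, 'q::finite, 'k::finite) discretization"
    and M :: "('m::finite, 'k) mesh" and a :: "real^3"
  assumes "valid_discretization D"
  defines "F \<equiv> \<lambda>u. u *\<^sub>R a"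
  shows "u \<bullet> ((transpose (chi_v D) ** weight_matrix D) *v (ref_div D M F m u + phys_div D M F m u))
    = (\<Sum>f\<in>UNIV. \<Sum>k\<in>UNIV. facet_weight D f k * (ref_normal f \<bullet> facet_ref_flux D M F m u f k) * (u \<bullet> chi_f D f k))"
proof -
  let ?g = "ref_flux_coeff D M F m u"
  let ?A = "advection_cofactor D M a m"
  let ?P = "transpose (chi_v D) ** weight_matrix D"
  have inv: "invertible (ref_mass D)"
    and deriv: "\<And>j. chi_v_deriv D j = chi_v D ** matrix_inv (ref_mass D) ** ref_stiffness D j"
    and ibp: "\<And>j. ref_stiffness D j + transpose (ref_stiffness D j) =
     (\<chi> b b'. \<Sum>f\<in>UNIV. \<Sum>k\<in>UNIV.
        chi_f D f k $ b * facet_weight D f k * ref_normal f $ j * chi_f D f k $ b')"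
    using assms(1) by (auto simp: valid_discretization_def discrete_integration_by_parts_def)
  \<comment> \<open>Discrete integration by parts, read as an identity of bilinear forms.\<close>
  have bilin: "x \<bullet> ((ref_stiffness D j + transpose (ref_stiffness D j)) *v y)
      = (\<Sum>f\<in>UNIV. \<Sum>k\<in>UNIV. facet_weight D f k * ref_normal f $ j * (chi_f D f k \<bullet> y) * (x \<bullet> chi_f D f k))"
    for x y j
  proof -
    have "x \<bullet> ((ref_stiffness D j + transpose (ref_stiffness D j)) *v y)
      = (\<Sum>b\<in>UNIV. \<Sum>b'\<in>UNIV. \<Sum>f\<in>UNIV. \<Sum>k\<in>UNIV. facet_weight D f k * ref_normal f $ j *
          (chi_f D f k $ b' * y $ b') * (x $ b * chi_f D f k $ b))"
      unfolding ibp
      by (simp add: inner_vec_def matrix_vector_mult_def sum_distrib_left sum_distrib_right mult_ac)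
    also have "\<dots> = (\<Sum>f\<in>UNIV. \<Sum>k\<in>UNIV. \<Sum>b\<in>UNIV. \<Sum>b'\<in>UNIV. facet_weight D f k * ref_normal f $ j *
          (chi_f D f k $ b' * y $ b') * (x $ b * chi_f D f k $ b))"
      by (simp only: sum.swap[where A="UNIV::'b set" and B="UNIV::face set"]
            sum.swap[where A="UNIV::'b set" and B="UNIV::'k set"])
    also have "\<dots> = (\<Sum>f\<in>UNIV. \<Sum>k\<in>UNIV. facet_weight D f k * ref_normal f $ j *
          ((x \<bullet> chi_f D f k) * (chi_f D f k \<bullet> y)))"
      unfolding inner_vec_def inner_real_def sum_product by (simp add: sum_distrib_left mult_ac)
    finally show ?thesis by (simp add: mult_ac)
  qed
  have "u \<bullet> (?P *v (ref_div D M F m u + phys_div D M F m u))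
      = (\<Sum>j\<in>UNIV. u \<bullet> (?P *v (chi_v_deriv D j *v ?g j + ?A j *v (chi_v_deriv D j *v u))))"
    by (simp add: F_def ref_div_def phys_div_advection[OF inv] matrix_vector_right_distrib
        inner_add_right sum.distrib linear_sum[OF matrix_vector_mul_linear] inner_sum_right)
  also have "\<dots> = (\<Sum>j\<in>UNIV. u \<bullet> ((ref_stiffness D j + transpose (ref_stiffness D j)) *v ?g j))"
  proof (rule sum.cong[OF refl])
    fix j
    show "u \<bullet> (?P *v (chi_v_deriv D j *v ?g j + ?A j *v (chi_v_deriv D j *v u)))
        = u \<bullet> ((ref_stiffness D j + transpose (ref_stiffness D j)) *v ?g j)"
      unfolding F_def ref_flux_coeff_advection L2_projection_def ref_mass_def
      by (rule split_form_energy)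
         (use inv deriv[of j] in \<open>simp_all add: ref_mass_def ref_stiffness_def weight_matrix_def
            advection_cofactor_def transpose_diag_matrix diag_matrix_mult_diag\<close>)
  qed
  also have "\<dots> = (\<Sum>f\<in>UNIV. \<Sum>k\<in>UNIV. \<Sum>j\<in>UNIV. facet_weight D f k * ref_normal f $ j *
      (chi_f D f k \<bullet> ?g j) * (u \<bullet> chi_f D f k))"
    by (simp only: bilin sum.swap[where A="UNIV::3 set" and B="UNIV::face set"]
            sum.swap[where A="UNIV::3 set" and B="UNIV::'k set"])
  also have "\<dots> = (\<Sum>f\<in>UNIV. \<Sum>k\<in>UNIV. facet_weight D f k * (ref_normal f \<bullet> facet_ref_flux D M F m u f k) * (u \<bullet> chi_f D f k))"
    by (simp add: facet_ref_flux_def inner_vec_def sum_distrib_left sum_distrib_right mult_ac)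
  finally show ?thesis .
qed

lemma element_energy_balance:
  assumes "valid_discretization D"
    and "scheme_residual D M (\<lambda>u. u *\<^sub>R a) m u du fs = 0"
  shows "u \<bullet> (norm_matrix D M m *v du) =
    - (\<Sum>f\<in>UNIV. \<Sum>k\<in>UNIV. sol_at D u (facet_node D f k) * facet_weight D f k *
        (scaled_normal D M m f k \<bullet> (fs f k - (1/2) *\<^sub>R (sol_at D u (facet_node D f k) *\<^sub>R a))))"
proof -
  let ?F = "\<lambda>u. u *\<^sub>R a"
  let ?u = "\<lambda>f k. u \<bullet> chi_f D f k"
  have inv: "invertible (ref_mass D)"
    using assms(1) by (simp add: valid_discretization_def)
  have flux: "facet_flux D ?F u f k = ?u f k *\<^sub>R a" for f k
    by (simp add: facet_flux_def flux_coeff_advection[OF inv] vec_eq_iff inner_commute mult.commute)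
  have corr: "ref_normal f \<bullet> correction_flux D M ?F m u fs f k =
      scaled_normal D M m f k \<bullet> (fs f k - (1/2) *\<^sub>R (?u f k *\<^sub>R a))
      - 1/2 * (ref_normal f \<bullet> facet_ref_flux D M ?F m u f k)" for f k
    unfolding correction_flux_def flux inner_diff_right inner_scaleR_right
      inner_vector_matrix_mult scaled_normal_def
    by (simp add: algebra_simps)
  have "0 = u \<bullet> scheme_residual D M ?F m u du fs"
    using assms(2) by simp
  also have "\<dots> = u \<bullet> (norm_matrix D M m *v du)
      + (\<Sum>f\<in>UNIV. \<Sum>k\<in>UNIV. ?u f k * facet_weight D f k *
          (scaled_normal D M m f k \<bullet> (fs f k - (1/2) *\<^sub>R (?u f k *\<^sub>R a))))"
    unfolding scheme_residual_def inner_add_right inner_scaleR_right inner_sum_right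
      split_volume_energy[OF assms(1)] corr sum_distrib_left add.assoc sum.distrib[symmetric]
    by (intro arg_cong2[where f="(+)"] refl sum.cong) (simp add: algebra_simps)
  finally show ?thesis by (simp add: sol_at_facet_node)
qed

section \<open>Evolution in time\<close>

lemma has_real_derivative_quadratic_form:
  fixes A :: "real^'n^'n"
  assumes A: "transpose A = A" and u: "(u has_vector_derivative du) (at t within T)"
  shows "((\<lambda>s. 1/2 * (u s \<bullet> (A *v u s))) has_real_derivative u t \<bullet> (A *v du)) (at t within T)"
proof -
  have Au: "((\<lambda>s. A *v u s) has_vector_derivative A *v du) (at t within T)"
    by (rule bounded_linear.has_vector_derivative[OF matrix_vector_mul_bounded_linear u])
  have "((\<lambda>s. u s \<bullet> (A *v u s)) has_vector_derivative
      u t \<bullet> (A *v du) + du \<bullet> (A *v u t)) (at t within T)"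
    by (rule bounded_bilinear.has_vector_derivative[OF bounded_bilinear_inner u Au])
  moreover have "du \<bullet> (A *v u t) = u t \<bullet> (A *v du)"
    using inner_transpose_mult[of du A "u t"] by (simp only: A inner_commute)
  ultimately have "((\<lambda>s. u s \<bullet> (A *v u s)) has_real_derivative 2 * (u t \<bullet> (A *v du))) (at t within T)"
    by (simp add: has_real_derivative_iff_has_vector_derivative)
  from DERIV_cmult[OF this, of "1/2"] show ?thesis by simp
qed

lemma has_real_derivative_nonpos_imp_antimono_on:
  fixes E :: "real \<Rightarrow> real"
  assumes T: "is_interval T"
    and der: "\<And>t. t \<in> T \<Longrightarrow> (E has_real_derivative E' t) (at t within T)"
    and le: "\<And>t. t \<in> T \<Longrightarrow> E' t \<le> 0"
  shows "antimono_on T E"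
proof (rule monotone_onI)
  fix x y assume xy: "x \<in> T" "y \<in> T" "x \<le> y"
  have sub: "{x..y} \<subseteq> T"
    using mem_is_interval_1_I[OF T xy(1,2)] by auto
  show "E x \<ge> E y"
  proof (cases "x = y")
    case False
    have "\<exists>s\<in>{x<..<y}. E y - E x = E' s * (y - x)"
    proof (rule mvt_simple)
      show "x < y" using xy False by simp
      show "(E has_derivative (*) (E' s)) (at s within {x..y})" if "x \<le> s" "s \<le> y" for s
        using DERIV_subset[OF der sub, of s] that subsetD[OF sub, of s]
        by (simp add: has_field_derivative_def)
    qed
    then obtain s where "s \<in> {x<..<y}" "E y - E x = E' s * (y - x)" ..
    moreover have "E' s * (y - x) \<le> 0"
      using \<open>s \<in> {x<..<y}\<close> xy subsetD[OF sub, of s]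
      by (intro mult_nonpos_nonneg le) simp_all
    ultimately show ?thesis by simp
  qed simp
qed

section \<open>Facet nodes of a periodic mesh\<close>

definition glued_node ::
  "('m, 'k) mesh \<Rightarrow> 'm \<times> face \<times> 'k \<Rightarrow> 'm \<times> face \<times> 'k" where
  "glued_node M = (\<lambda>(m, f, k). 
     case the (neighbour M (m, f)) of (m', f') \<Rightarrow> (m', f', node_match M (m, f) k))"

lemma neighbour_exists:
  assumes "periodic_mesh M"
  shows "\<exists>m' f'. neighbour M (m, f) = Some (m', f')"
proof (cases "neighbour M (m, f)")
  case None
  then show ?thesis using assms unfolding periodic_mesh_def by blast
next
  case (Some F)
  then show ?thesis by (cases F) blast
qed

lemma conforming_meshD:
  assumes "conforming_mesh D M" "neighbour M (m, f) = Some (m', f')"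
  shows "neighbour M (m', f') = Some (m, f)"
    and "node_match M (m', f') (node_match M (m, f) k) = k"
    and "facet_weight D f' (node_match M (m, f) k) = facet_weight D f k"
    and "scaled_normal D M m' f' (node_match M (m, f) k) = - scaled_normal D M m f k"
  using conjunct2[OF conjunct2[OF assms(1)[unfolded conforming_mesh_def]],
      THEN spec, THEN spec, THEN spec, THEN spec, THEN mp, OF assms(2)]
  by simp_all

lemma sum_facet_nodes_symmetrize:
  fixes D :: "('b::finite, 'q::finite, 'k::finite) discretization"
    and M :: "('m::finite, 'k) mesh" and h :: "'m \<times> face \<times> 'k \<Rightarrow> real"
  assumes "conforming_mesh D M" "periodic_mesh M"
  shows "2 * (\<Sum>m\<in>UNIV. \<Sum>f\<in>UNIV. \<Sum>k\<in>UNIV. h (m, f, k)) = (\<Sum>x\<in>UNIV. h x + h (glued_node M x))"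
proof -
  have "glued_node M (glued_node M x) = x" for x
  proof (cases x)
    case (fields m f k)
    obtain m' f' where n: "neighbour M (m, f) = Some (m', f')"
      using neighbour_exists[OF assms(2)] by blast
    show ?thesis
      by (simp add: fields glued_node_def n conforming_meshD(1,2)[OF assms(1) n])
  qed
  then have "bij (glued_node M)" by (metis involuntory_imp_bij)
  then have "(\<Sum>x\<in>UNIV. h (glued_node M x)) = (\<Sum>x\<in>UNIV. h x)"
    by (rule sum.reindex_bij_betw)
  moreover have "(\<Sum>m\<in>UNIV. \<Sum>f\<in>UNIV. \<Sum>k\<in>UNIV. h (m, f, k)) = (\<Sum>x\<in>UNIV. h x)"
    by (simp add: sum.cartesian_product UNIV_Times_UNIV)
  ultimately show ?thesis by (simp add: sum.distrib)
qed

text \<open>The rate at which the energy \<open>1/2 norm_sq\<close> leaves an element through one facet node.\<close>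
definition energy_flux ::
  "('b::finite, 'q::finite, 'k::finite) discretization \<Rightarrow> ('m::finite, 'k) mesh \<Rightarrow> real^3 \<Rightarrow>
   ('m \<Rightarrow> real \<Rightarrow> real^'b) \<Rightarrow> (real \<Rightarrow> 'm \<Rightarrow> face \<Rightarrow> 'k \<Rightarrow> real^3) \<Rightarrow> real \<Rightarrow>
   'm \<times> face \<times> 'k \<Rightarrow> real" where
  "energy_flux D M a uh fstar t = (\<lambda>(m, f, k).
     facet_sol D uh t m f k * facet_weight D f k *
       (scaled_normal D M m f k \<bullet>
          (fstar t m f k - (1/2) *\<^sub>R (facet_sol D uh t m f k *\<^sub>R a))))"

text \<open>Seen from the neighbour, the node has the same weight and the opposite scaled normal, so the
  outflow there can be expressed through the geometry of the near side.\<close>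
lemma energy_flux_glued:
  assumes "conforming_mesh D M" "neighbour M (m, f) = Some (m', f')"
    and k': "k' = node_match M (m, f) k"
  shows "energy_flux D M a uh fstar t (glued_node M (m, f, k)) =
     - (facet_sol D uh t m' f' k' * facet_weight D f k *
       (scaled_normal D M m f k \<bullet> (fstar t m' f' k' - (1/2) *\<^sub>R (facet_sol D uh t m' f' k' *\<^sub>R a))))"
proof -
  show ?thesis
    by (simp add: energy_flux_def glued_node_def k' assms(2) conforming_meshD(3,4)[OF assms(1,2)])
qed

text \<open>On each side the average minus half of the own value leaves half of the value across the
  facet, so the outflow is \<open>\<plusminus> \<nu> \<bullet> a u\<^sup>- u\<^sup>+ / 2\<close> up to the weight.\<close>
lemma energy_flux_central:
  assumes "conforming_mesh D M" "periodic_mesh M" "central_flux D M a T uh fstar" "t \<in> T"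
  shows "energy_flux D M a uh fstar t x + energy_flux D M a uh fstar t (glued_node M x) = 0"
proof (cases x)
  case (fields m f k)
  obtain m' f' where n: "neighbour M (m, f) = Some (m', f')"
    using neighbour_exists[OF assms(2)] by blast
  let ?k = "node_match M (m, f) k"
  note n' = conforming_meshD(1,2)[OF assms(1) n]
  have central: "fstar t m f k = ((facet_sol D uh t m f k +
        facet_sol D uh t m' f' (node_match M (m, f) k)) / 2) *\<^sub>R a"
    if "neighbour M (m, f) = Some (m', f')" for m f m' f' k
    using assms(3,4) that unfolding central_flux_def Let_def by blast
  note 1 = central[OF n, of k]
  have 2: "fstar t m' f' ?k = ((facet_sol D uh t m' f' ?k + facet_sol D uh t m f k) / 2) *\<^sub>R a"
    using central[OF n'(1), of ?k] by (simp add: n'(2))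
  show ?thesis
    unfolding fields energy_flux_glued[OF assms(1) n refl]
    unfolding energy_flux_def prod.case 1 2
    by (simp add: inner_diff_right field_simps)
qed

text \<open>The averages cancel as for the central flux. What is left is the jump penalty tested with the
  jump itself, and its sign rests on the positivity of the facet weights.\<close>
lemma energy_flux_upwind:
  assumes "valid_discretization D" "conforming_mesh D M" "periodic_mesh M"
    "upwind_flux D M a T uh fstar" "t \<in> T"
  shows "energy_flux D M a uh fstar t x + energy_flux D M a uh fstar t (glued_node M x) \<ge> 0"
proof (cases x)
  case (fields m f k)
  obtain m' f' where n: "neighbour M (m, f) = Some (m', f')"
    using neighbour_exists[OF assms(3)] by blast
  define um where "um = facet_sol D uh t m f k"
  define up where "up = facet_sol D uh t m' f' (node_match M (m, f) k)"
  define w where "w = facet_weight D f k"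
  define \<nu> where "\<nu> = scaled_normal D M m f k"
  have "w > 0"
    using assms(1) unfolding valid_discretization_def w_def by blast
  have 1: "fstar t m' f' (node_match M (m, f) k) = fstar t m f k"
    "\<nu> \<bullet> fstar t m f k = (\<nu> \<bullet> a) * ((um + up) / 2) + 1/2 * \<bar>\<nu> \<bullet> a\<bar> * (um - up)"
    using assms(4,5) n unfolding upwind_flux_def Let_def um_def up_def \<nu>_def by blast+
  have "energy_flux D M a uh fstar t x + energy_flux D M a uh fstar t (glued_node M x)
      = w * \<bar>\<nu> \<bullet> a\<bar> * (um - up)\<^sup>2 / 2"
    unfolding fields energy_flux_glued[OF assms(2) n refl]
    unfolding energy_flux_def prod.case 1(1)
    by (simp add: um_def[symmetric] up_def[symmetric] w_def[symmetric] \<nu>_def[symmetric]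
        inner_diff_right 1(2)) (simp add: field_simps power2_eq_square)
  moreover have "w * \<bar>\<nu> \<bullet> a\<bar> * (um - up)\<^sup>2 / 2 \<ge> 0"
    using \<open>w > 0\<close> by simp
  ultimately show ?thesis by linarith
qed

theorem mainTheorem1:
  fixes D :: "('b::finite, 'q::finite, 'k::finite) discretization"
    and M :: "('m::finite, 'k) mesh"
    and a :: "real^3"
    and T :: "real set"
    and uh :: "'m \<Rightarrow> real \<Rightarrow> real^'b"
    and fstar :: "real \<Rightarrow> 'm \<Rightarrow> face \<Rightarrow> 'k \<Rightarrow> real^3"
  assumes "valid_discretization D"
    and "valid_elements M"
    and "conforming_mesh D M"
    and "\<And>m. sym_pos_def (norm_matrix D M m)"
    and "is_interval T"
    and "solves_scheme D M (\<lambda>u. u *\<^sub>R a) T uh fstar"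
  shows "(\<forall>t\<in>T. \<forall>m.
            ((\<lambda>s. 1/2 * norm_sq D M m (uh m s)) has_real_derivative
              - (\<Sum>f\<in>UNIV. \<Sum>k\<in>UNIV.
                   facet_sol D uh t m f k * facet_weight D f k *
                   (scaled_normal D M m f k \<bullet>
                      (fstar t m f k - (1/2) *\<^sub>R (facet_sol D uh t m f k *\<^sub>R a)))))
            (at t within T))
         \<and> (periodic_mesh M \<longrightarrow>
              (central_flux D M a T uh fstar \<longrightarrow> total_energy D M uh constant_on T) \<and>
              (upwind_flux D M a T uh fstar \<longrightarrow> antimono_on T (total_energy D M uh)))"
proof -
  let ?h = "energy_flux D M a uh fstar"
  let ?E = "total_energy D M uh"
  have elem: "((\<lambda>s. 1/2 * norm_sq D M m (uh m s)) has_real_derivative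
      - (\<Sum>f\<in>UNIV. \<Sum>k\<in>UNIV. ?h t (m, f, k))) (at t within T)" if "t \<in> T" for t m
  proof -
    obtain du where du: "(uh m has_vector_derivative du) (at t within T)"
        "scheme_residual D M (\<lambda>u. u *\<^sub>R a) m (uh m t) du (fstar t m) = 0"
      using assms(6) \<open>t \<in> T\<close> unfolding solves_scheme_def by blast
    have "transpose (norm_matrix D M m) = norm_matrix D M m"
      using assms(4) by (simp add: sym_pos_def_def)
    from has_real_derivative_quadratic_form[OF this du(1)] show ?thesis
      by (simp add: element_energy_balance[OF assms(1) du(2)] norm_sq_def energy_flux_def
          facet_sol_def)
  qed
  have total: "(?E has_real_derivative - (\<Sum>x\<in>UNIV. ?h t x + ?h t (glued_node M x))) (at t within T)"
    if "t \<in> T" "periodic_mesh M" for t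
  proof -
    have "((\<lambda>s. \<Sum>m\<in>UNIV. 2 * (1/2 * norm_sq D M m (uh m s))) has_real_derivative
        (\<Sum>m\<in>UNIV. 2 * - (\<Sum>f\<in>UNIV. \<Sum>k\<in>UNIV. ?h t (m, f, k)))) (at t within T)"
      by (intro DERIV_sum DERIV_cmult elem \<open>t \<in> T\<close>)
    moreover have "(\<lambda>s. \<Sum>m\<in>UNIV. 2 * (1/2 * norm_sq D M m (uh m s))) = ?E"
      by (simp add: total_energy_def fun_eq_iff)
    ultimately show ?thesis
      using sum_facet_nodes_symmetrize[OF assms(3) that(2), of "?h t"]
      by (simp add: sum_negf sum_distrib_left)
  qed
  have central: "?E constant_on T" if "periodic_mesh M" "central_flux D M a T uh fstar"
  proof -
    have "(?E has_real_derivative 0) (at t within T)" if "t \<in> T" for t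
      using total[OF \<open>t \<in> T\<close> \<open>periodic_mesh M\<close>]
      by (simp add: energy_flux_central[OF assms(3) \<open>periodic_mesh M\<close> \<open>central_flux D M a T uh fstar\<close> \<open>t \<in> T\<close>])
    then show ?thesis
      using has_field_derivative_zero_constant[of T ?E] is_interval_convex[OF assms(5)]
      unfolding constant_on_def by blast
  qed
  have upwind: "antimono_on T ?E" if "periodic_mesh M" "upwind_flux D M a T uh fstar"
  proof (rule has_real_derivative_nonpos_imp_antimono_on[OF assms(5)])
    show "- (\<Sum>x\<in>UNIV. ?h t x + ?h t (glued_node M x)) \<le> 0" if "t \<in> T" for t
      using energy_flux_upwind[OF assms(1,3) \<open>periodic_mesh M\<close> \<open>upwind_flux D M a T uh fstar\<close> \<open>t \<in> T\<close>]
      by (simp add: sum_nonneg)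
  qed (rule total[OF _ \<open>periodic_mesh M\<close>])
  show ?thesis
    using elem central upwind by (auto simp: energy_flux_def)
qed
end
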